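(* Let $\mathcal{V}=\alpha+j\beta=\nu_1e_1+\nu_2e_2$ ($\alpha,\beta\in\mathbb{C}(i)$), $C=c_1e_1+c_2e_2\in\mathbb{BC}$ and $c>0$, with $\Re(\alpha)>|\Im(\beta)|$. Then the solution of the bicomplex fractional integral equation $$N(t)-N_0\exp(Ct)=-c^{\mathcal{V}}D_t^{-\mathcal{V}}N(t),$$ where $N_0$ is a constant, is given by $$N(t)=\sum_{k=0}^{\infty}N_0\,(-c^{\mathcal{V}})^k\,E_{\mathcal{V}k,C}(t).$$
   Context: Bicomplex numbers: $\mathbb{BC}=\{w_1+jw_2: w_1,w_2\in\mathbb{C}(i)\}$, where $\mathbb{C}(i)$ is the complex field with unit $i$, $i^2=j^2=-1$, $ij=ji$. Put $e_1=\frac{1+ij}{2}$, $e_2=\frac{1-ij}{2}$, so $e_1+e_2=1$, $e_l^2=e_l$, $e_1e_2=0$. Every $Z=w_1+jw_2$ is uniquely $Z=z_1e_1+z_2e_2$ with $z_1=w_1-iw_2$, $z_2=w_1+iw_2\in\mathbb{C}(i)$, and addition, multiplication and division are componentwise in $e_1,e_2$; in particular $\nu_1=\alpha-i\beta$, $\nu_2=\alpha+i\beta$. Functions act componentwise: $\Gamma(Y)=\Gamma(y_1)e_1+\Gamma(y_2)e_2$, $\exp(Y)=e^{y_1}e_1+e^{y_2}e_2$, and for $x>0$ and $W=w_1e_1+w_2e_2$, $x^W=x^{w_1}e_1+x^{w_2}e_2$. Bicomplex Miller-Ross function: $E_{\mathcal{V},C}(Z)=Z^{\mathcal{V}}\sum_{r=0}^{\infty}\frac{(CZ)^r}{\Gamma(\mathcal{V}+r+1)}$;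 here it is evaluated at real $t>0$. Here $t>0$, and $N$ is the unknown bicomplex-valued function, locally integrable on $[0,\infty)$. $D_t^{-\mathcal{V}}$ is the Riemann-Liouville fractional integral of bicomplex order: for $f=f_1e_1+f_2e_2$, $D_t^{-\mathcal{V}}f=(D_t^{-\nu_1}f_1)e_1+(D_t^{-\nu_2}f_2)e_2$, with $D_t^{-\nu}g(t)=\frac{1}{\Gamma(\nu)}\int_0^t(t-\tau)^{\nu-1}g(\tau)\,d\tau$ for $\Re\nu>0$ (note $\Re(\alpha)>|\Im(\beta)|$ says $\Re\nu_1,\Re\nu_2>0$). *)

theory Defs
  imports "HOL-Analysis.Analysis"
begin

section \<open>Bicomplex numbers\<close>

text \<open>\<open>BC w1 w2\<close> stands for \<open>w1 + j w2\<close>.\<close>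

datatype bicomplex = BC (cpart: complex) (jpart: complex)

lemma bicomplex_eq_iff: "Z = W \<longleftrightarrow> cpart Z = cpart W \<and> jpart Z = jpart W"
  by (auto intro: bicomplex.expand)

instantiation bicomplex :: comm_ring_1
begin

definition "0 = BC 0 0"
definition "1 = BC 1 0"
definition "Z + W = BC (cpart Z + cpart W) (jpart Z + jpart W)"
definition "Z - W = BC (cpart Z - cpart W) (jpart Z - jpart W)"
definition "- Z = BC (- cpart Z) (- jpart Z)"
definition "Z * W = BC (cpart Z * cpart W - jpart Z * jpart W)
                       (cpart Z * jpart W + jpart Z * cpart W)"

instance
  by standard
    (auto simp: bicomplex_eq_iff zero_bicomplex_def one_bicomplex_def plus_bicomplex_def
      minus_bicomplex_def uminus_bicomplex_def times_bicomplex_def algebra_simps)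

end

lemma bicomplex_sel_simps [simp]:
  "cpart 0 = 0" "jpart 0 = 0"
  "cpart 1 = 1" "jpart 1 = 0"
  "cpart (Z + W) = cpart Z + cpart W" "jpart (Z + W) = jpart Z + jpart W"
  "cpart (Z - W) = cpart Z - cpart W" "jpart (Z - W) = jpart Z - jpart W"
  "cpart (- Z) = - cpart Z" "jpart (- Z) = - jpart Z"
  "cpart (Z * W) = cpart Z * cpart W - jpart Z * jpart W"
  "jpart (Z * W) = cpart Z * jpart W + jpart Z * cpart W"
  by (simp_all add: zero_bicomplex_def one_bicomplex_def plus_bicomplex_def
      minus_bicomplex_def uminus_bicomplex_def times_bicomplex_def)

instantiation bicomplex :: real_algebra_1
begin

definition "scaleR r Z = BC (scaleR r (cpart Z)) (scaleR r (jpart Z))"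

instance
  by standard (auto simp: bicomplex_eq_iff scaleR_bicomplex_def algebra_simps)

end

lemma bicomplex_scaleR_simps [simp]:
  "cpart (scaleR r Z) = scaleR r (cpart Z)" "jpart (scaleR r Z) = scaleR r (jpart Z)"
  by (simp_all add: scaleR_bicomplex_def)

lemma bicomplex_of_real_simps [simp]:
  "cpart (of_real r) = of_real r" "jpart (of_real r) = 0"
  by (simp_all add: of_real_def)

text \<open>The topology and the norm are those of \<open>\<complex>\<^sup>2\<close>, that is, the Euclidean ones.\<close>

instantiation bicomplex :: real_inner
begin

definition "inner Z W = inner (cpart Z) (cpart W) + inner (jpart Z) (jpart W)"
definition "norm (Z::bicomplex) = sqrt (inner Z Z)"
definition "dist (Z::bicomplex) W = norm (Z - W)"
definition "sgn (Z::bicomplex) = Z /\<^sub>R norm Z"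
definition "(uniformity :: (bicomplex \<times> bicomplex) filter) =
  (INF e\<in>{0 <..}. principal {(Z, W). dist Z W < e})"
definition "open (U :: bicomplex set) \<longleftrightarrow>
  (\<forall>Z\<in>U. eventually (\<lambda>(Z', W). Z' = Z \<longrightarrow> W \<in> U) uniformity)"

instance
proof
  fix Z W X :: bicomplex and r :: real and U :: "bicomplex set"
  show "inner Z W = inner W Z"
    by (simp add: inner_bicomplex_def inner_commute)
  show "inner (Z + W) X = inner Z X + inner W X"
    by (simp add: inner_bicomplex_def inner_add_left)
  show "inner (scaleR r Z) W = r * inner Z W"
    by (simp add: inner_bicomplex_def distrib_left)
  show "0 \<le> inner Z Z"
    by (simp add: inner_bicomplex_def)
  show "inner Z Z = 0 \<longleftrightarrow> Z = 0"
    by (simp add: inner_bicomplex_def bicomplex_eq_iff add_nonneg_eq_0_iff)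
  show "dist Z W = norm (Z - W)"
    by (rule dist_bicomplex_def)
  show "sgn Z = Z /\<^sub>R norm Z"
    by (rule sgn_bicomplex_def)
  show "(uniformity :: (bicomplex \<times> bicomplex) filter) =
      (INF e\<in>{0 <..}. principal {(Z, W). dist Z W < e})"
    by (rule uniformity_bicomplex_def)
  show "open U \<longleftrightarrow> (\<forall>Z\<in>U. eventually (\<lambda>(Z', W). Z' = Z \<longrightarrow> W \<in> U) uniformity)"
    by (rule open_bicomplex_def)
  show "norm Z = sqrt (inner Z Z)"
    by (rule norm_bicomplex_def)
qed

end

instantiation bicomplex :: euclidean_space
begin

definition "Basis = {BC 1 0, BC \<i> 0, BC 0 1, BC 0 \<i>}"

instance
proof
  fix u v Z :: bicomplex
  show "(Basis :: bicomplex set) \<noteq> {}" "finite (Basis :: bicomplex set)"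
    by (simp_all add: Basis_bicomplex_def)
  show "inner u v = (if u = v then 1 else 0)" if "u \<in> Basis" "v \<in> Basis"
    using that unfolding Basis_bicomplex_def insert_iff empty_iff
    by (elim disjE FalseE) (simp_all add: inner_bicomplex_def complex_eq_iff)
  show "(\<forall>u\<in>Basis. inner Z u = 0) \<longleftrightarrow> Z = 0"
    by (auto simp: Basis_bicomplex_def inner_bicomplex_def bicomplex_eq_iff[of Z 0]
        complex_eq_iff[of _ 0])
qed

end

definition of_complex :: "complex \<Rightarrow> bicomplex" where
  "of_complex w = BC w 0"

definition bc_j :: bicomplex where
  "bc_j = BC 0 1"

lemma bicomplex_decomp: "Z = of_complex (cpart Z) + bc_j * of_complex (jpart Z)"
  by (simp add: bicomplex_eq_iff of_complex_def bc_j_def)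

lemma bc_j_squared: "bc_j * bc_j = -1"
  by (simp add: bicomplex_eq_iff bc_j_def)


subsection \<open>Idempotent representation\<close>

definition bc_e1 :: bicomplex where
  "bc_e1 = (1 + of_complex \<i> * bc_j) /\<^sub>R 2"

definition bc_e2 :: bicomplex where
  "bc_e2 = (1 - of_complex \<i> * bc_j) /\<^sub>R 2"

definition of_idem :: "complex \<Rightarrow> complex \<Rightarrow> bicomplex" where
  "of_idem z1 z2 = of_complex z1 * bc_e1 + of_complex z2 * bc_e2"

definition idem1 :: "bicomplex \<Rightarrow> complex" where
  "idem1 Z = cpart Z - \<i> * jpart Z"

definition idem2 :: "bicomplex \<Rightarrow> complex" where
  "idem2 Z = cpart Z + \<i> * jpart Z"

lemma cpart_of_idem: "cpart (of_idem z1 z2) = (z1 + z2) / 2"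
  by (simp add: of_idem_def bc_e1_def bc_e2_def of_complex_def bc_j_def scaleR_conv_of_real
      field_simps)

lemma jpart_of_idem: "jpart (of_idem z1 z2) = \<i> * (z1 - z2) / 2"
  by (simp add: of_idem_def bc_e1_def bc_e2_def of_complex_def bc_j_def scaleR_conv_of_real
      field_simps)

lemma idem_of_idem [simp]: "idem1 (of_idem z1 z2) = z1" "idem2 (of_idem z1 z2) = z2"
  by (simp_all add: idem1_def idem2_def cpart_of_idem jpart_of_idem field_simps)

lemma bc_idem_eq_iff: "Z = W \<longleftrightarrow> idem1 Z = idem1 W \<and> idem2 Z = idem2 W"
proof
  assume "idem1 Z = idem1 W \<and> idem2 Z = idem2 W"
  then have *: "cpart Z - \<i> * jpart Z = cpart W - \<i> * jpart W"
      "cpart Z + \<i> * jpart Z = cpart W + \<i> * jpart W"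
    by (simp_all add: idem1_def idem2_def)
  have "2 * cpart Z = 2 * cpart W"
    using arg_cong2[OF *, of "(+)"] by simp
  with * show "Z = W" by (simp add: bicomplex_eq_iff)
qed simp

lemma of_idem_idem: "of_idem (idem1 Z) (idem2 Z) = Z"
  by (simp add: bc_idem_eq_iff)

lemma idem_simps [simp]:
  "idem1 0 = 0" "idem2 0 = 0"
  "idem1 1 = 1" "idem2 1 = 1"
  "idem1 (Z + W) = idem1 Z + idem1 W" "idem2 (Z + W) = idem2 Z + idem2 W"
  "idem1 (Z - W) = idem1 Z - idem1 W" "idem2 (Z - W) = idem2 Z - idem2 W"
  "idem1 (- Z) = - idem1 Z" "idem2 (- Z) = - idem2 Z"
  "idem1 (Z * W) = idem1 Z * idem1 W" "idem2 (Z * W) = idem2 Z * idem2 W"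
  "idem1 (of_real r) = of_real r" "idem2 (of_real r) = of_real r"
  by (simp_all add: idem1_def idem2_def algebra_simps)

text \<open>Division is componentwise.  As usual in HOL it is total, with \<open>z / 0 = 0\<close> in each
  component; it is genuine division whenever both components of the divisor are nonzero.\<close>

instantiation bicomplex :: inverse
begin

definition "inverse Z = of_idem (inverse (idem1 Z)) (inverse (idem2 Z))"
definition "Z div W = of_idem (idem1 Z / idem1 W) (idem2 Z / idem2 W)"

instance ..

end

lemma bicomplex_divide_mult:
  fixes Z W :: bicomplex
  assumes "idem1 W \<noteq> 0" "idem2 W \<noteq> 0"
  shows "Z / W * W = Z"
  using assms by (simp add: bc_idem_eq_iff divide_bicomplex_def)


section \<open>Bicomplex functions\<close>

definition bc_exp :: "bicomplex \<Rightarrow> bicomplex" where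
  "bc_exp Z = of_idem (exp (idem1 Z)) (exp (idem2 Z))"

definition bc_Gamma :: "bicomplex \<Rightarrow> bicomplex" where
  "bc_Gamma Z = of_idem (Gamma (idem1 Z)) (Gamma (idem2 Z))"

text \<open>Principal powers in each component.  For \<open>Z = of_real x\<close> with \<open>x > 0\<close>, the only case
  used, this is \<open>x\<^sup>W = exp (W ln x)\<close> and there is no choice of branch.\<close>

definition bc_powr :: "bicomplex \<Rightarrow> bicomplex \<Rightarrow> bicomplex" where
  "bc_powr Z W = of_idem (idem1 Z powr idem1 W) (idem2 Z powr idem2 W)"

definition miller_ross_term :: "bicomplex \<Rightarrow> bicomplex \<Rightarrow> bicomplex \<Rightarrow> nat \<Rightarrow> bicomplex" where
  "miller_ross_term V C Z r = (C * Z) ^ r / bc_Gamma (V + of_nat r + 1)"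

definition miller_ross :: "bicomplex \<Rightarrow> bicomplex \<Rightarrow> bicomplex \<Rightarrow> bicomplex" where
  "miller_ross V C Z = bc_powr Z V * (\<Sum>r. miller_ross_term V C Z r)"


section \<open>Riemann-Liouville integrals of bicomplex order\<close>

definition RL_integrable :: "complex \<Rightarrow> (real \<Rightarrow> complex) \<Rightarrow> real \<Rightarrow> bool" where
  "RL_integrable \<nu> g t \<longleftrightarrow>
     (\<lambda>\<tau>. of_real (t - \<tau>) powr (\<nu> - 1) * g \<tau>) absolutely_integrable_on {0..t}"

definition RL_integral :: "complex \<Rightarrow> (real \<Rightarrow> complex) \<Rightarrow> real \<Rightarrow> complex" where
  "RL_integral \<nu> g t =
     1 / Gamma \<nu> * (LINT \<tau>:{0..t}|lebesgue. of_real (t - \<tau>) powr (\<nu> - 1) * g \<tau>)"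

definition bc_RL_integrable :: "bicomplex \<Rightarrow> (real \<Rightarrow> bicomplex) \<Rightarrow> real \<Rightarrow> bool" where
  "bc_RL_integrable V f t \<longleftrightarrow>
     RL_integrable (idem1 V) (\<lambda>\<tau>. idem1 (f \<tau>)) t \<and> RL_integrable (idem2 V) (\<lambda>\<tau>. idem2 (f \<tau>)) t"

definition bc_RL_integral :: "bicomplex \<Rightarrow> (real \<Rightarrow> bicomplex) \<Rightarrow> real \<Rightarrow> bicomplex" where
  "bc_RL_integral V f t =
     of_idem (RL_integral (idem1 V) (\<lambda>\<tau>. idem1 (f \<tau>)) t) (RL_integral (idem2 V) (\<lambda>\<tau>. idem2 (f \<tau>)) t)"

definition locally_integrable :: "(real \<Rightarrow> bicomplex) \<Rightarrow> bool" where
  "locally_integrable f \<longleftrightarrow> (\<forall>b>0. f absolutely_integrable_on {0..b})"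

text \<open>The Lebesgue integral of a non-integrable function is 0 in HOL, so a solution is required
  explicitly to have a fractional integral at every \<open>t > 0\<close>.\<close>

definition solves_frac_eq ::
  "bicomplex \<Rightarrow> bicomplex \<Rightarrow> real \<Rightarrow> bicomplex \<Rightarrow> (real \<Rightarrow> bicomplex) \<Rightarrow> bool" where
  "solves_frac_eq V C c N0 N \<longleftrightarrow>
     locally_integrable N \<and>
     (\<forall>t>0. bc_RL_integrable V N t \<and>
        N t - N0 * bc_exp (C * of_real t) = - bc_powr (of_real c) V * bc_RL_integral V N t)"

end

theory Submission
  imports Defs
begin

text \<open>In the idempotent basis the equation splits into two complex equations
  \<open>N(t) - n0 exp(c t) = - \<kappa> (I N)(t)\<close>, where \<open>I\<close> is the Riemann-Liouville integral of an order \<open>\<nu>\<close> with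
  \<open>Re \<nu> > 0\<close>.  By the complex Beta integral, \<open>I\<close> maps \<open>t powr (\<nu>k + r) / \<Gamma>(\<nu>k + r + 1)\<close> to the same
  expression with \<open>k + 1\<close> in place of \<open>k\<close>.  The double series over \<open>k\<close> and \<open>r\<close> is dominated by a
  geometric one uniformly on \<open>[0, T]\<close>, so \<open>I\<close> may be applied termwise and shifts the Neumann series
  by one.  The modulus \<open>m\<close> of the difference of two solutions is at most a constant times its integral
  of order \<open>Re \<nu>\<close>.  With the weight \<open>exp(- l t)\<close> for large \<open>l\<close> this operator is a contraction in
  \<open>L\<^sup>1[0, T]\<close>, so \<open>m = 0\<close> almost everywhere, and then everywhere by the equation.\<close>

section \<open>Complex powers of real numbers\<close>

lemma norm_of_real_powr:
  "t \<ge> 0 \<Longrightarrow> norm (complex_of_real t powr z) = t powr Re z"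
  by (cases "t = 0") (auto simp: norm_powr_real powr_def mult.commute)

text \<open>Without the complex logarithm only real \<open>ln\<close> and the continuous
  \<open>exp\<close> remain, from which measurability follows. The negative case matters because the
  kernel base \<open>t - \<tau>\<close> is negative for \<open>\<tau> > t\<close>.\<close>

lemma of_real_powr_complex:
  "complex_of_real t powr z =
     (if t = 0 then 0
      else if t > 0 then exp (z * of_real (ln t))
      else exp (z * (of_real (ln (- t)) + \<i> * pi)))"
  by (auto simp: powr_def Ln_of_real' mult.commute)

lemma borel_measurable_of_real_powr [measurable]:
  assumes [measurable]: "f \<in> borel_measurable M"
  shows "(\<lambda>x. complex_of_real (f x) powr z) \<in> borel_measurable M"
proof -
  have [measurable]: "(\<lambda>x. exp (g x)) \<in> borel_measurable M"
    if "g \<in> borel_measurable M" for g :: "_ \<Rightarrow> complex"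
    using that by (rule borel_measurable_continuous_on[rotated]) (intro continuous_intros)
  show ?thesis
    unfolding of_real_powr_complex by measurable
qed

lemma powr_of_real_mult:
  assumes "x \<ge> 0" "y \<ge> 0"
  shows "complex_of_real (x * y) powr z = complex_of_real x powr z * complex_of_real y powr z"
  using powr_times_real[of "of_real x" "of_real y" z] assms by simp

section \<open>The Beta integral with complex parameters\<close>

lemma Beta_integrand_integrable:
  assumes "Re a > 0" "Re b > 0"
  shows "set_integrable lborel {0..1}
           (\<lambda>t. complex_of_real t powr (a - 1) * complex_of_real (1 - t) powr (b - 1))"
  by (rule set_integrable_bound[OF integrable_Beta[of "Re a" "Re b"]])
     (use assms in \<open>auto simp: set_borel_measurable_def norm_mult norm_of_real_powr simp del: of_real_diff\<close>)

text \<open>Substituting \<open>u * t\<close> for \<open>t\<close>, each factor yields a power of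
  \<open>u\<close> and the differential one more:
  \<open>1 + (a - 1) + (b - 1) = a + b - 1\<close>.\<close>

lemma Beta_integrand_scaled:
  fixes u :: real
  assumes "u > 0"
  shows "(LINT t:{0..u}|lborel. complex_of_real t powr (a - 1) * complex_of_real (u - t) powr (b - 1)) =
         of_real u powr (a + b - 1) *
           (LINT t:{0..1}|lborel. complex_of_real t powr (a - 1) * complex_of_real (1 - t) powr (b - 1))"
    (is "?L = _ * ?R")
proof -
  have "?L = u *\<^sub>R (LINT t|lborel. indicator {0..u} (u * t) *\<^sub>R
         (complex_of_real (u * t) powr (a - 1) * complex_of_real (u - u * t) powr (b - 1)))"
    unfolding set_lebesgue_integral_def
    using assms by (subst lborel_integral_real_affine[where c = u and t = 0]) auto
  also have "(\<lambda>t. indicator {0..u} (u * t) *\<^sub>R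
         (complex_of_real (u * t) powr (a - 1) * complex_of_real (u - u * t) powr (b - 1))) =
       (\<lambda>t. (of_real u powr (a - 1) * of_real u powr (b - 1)) * (indicator {0..1} t *\<^sub>R
         (complex_of_real t powr (a - 1) * complex_of_real (1 - t) powr (b - 1))))"
  proof
    fix t
    have "complex_of_real (u * t) powr (a - 1) = of_real u powr (a - 1) * of_real t powr (a - 1)"
         "complex_of_real (u * (1 - t)) powr (b - 1) = of_real u powr (b - 1) * of_real (1 - t) powr (b - 1)"
      if "t \<in> {0..1}"
      using that assms by (auto intro!: powr_of_real_mult simp del: of_real_mult of_real_diff)
    moreover have "u * t \<in> {0..u} \<longleftrightarrow> t \<in> {0..1}"
      using assms by (auto simp: zero_le_mult_iff)
    ultimately show "indicator {0..u} (u * t) *\<^sub>R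
         (complex_of_real (u * t) powr (a - 1) * complex_of_real (u - u * t) powr (b - 1)) =
       (of_real u powr (a - 1) * of_real u powr (b - 1)) * (indicator {0..1} t *\<^sub>R
         (complex_of_real t powr (a - 1) * complex_of_real (1 - t) powr (b - 1)))"
      by (auto simp: indicator_def right_diff_distrib)
  qed
  also have "u *\<^sub>R (LINT t|lborel. (of_real u powr (a - 1) * of_real u powr (b - 1)) * (indicator {0..1} t *\<^sub>R
         (complex_of_real t powr (a - 1) * complex_of_real (1 - t) powr (b - 1)))) =
     (of_real u * (of_real u powr (a - 1) * of_real u powr (b - 1))) * ?R"
    unfolding set_lebesgue_integral_def
    by (subst integral_mult_right_zero) (simp add: scaleR_conv_of_real)
  also have "of_real u * (of_real u powr (a - 1) * of_real u powr (b - 1)) =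
      complex_of_real u powr 1 * of_real u powr (a - 1) * of_real u powr (b - 1)"
    using assms by simp
  also have "\<dots> = of_real u powr (a + b - 1)"
    by (simp only: powr_add [symmetric]) (simp add: algebra_simps)
  finally show ?thesis .
qed

lemma Gamma_nonzero_of_Re_pos: "Re z > 0 \<Longrightarrow> Gamma z \<noteq> 0"
  by (auto simp: Gamma_eq_zero_iff elim!: nonpos_Ints_cases)

text \<open>Fubini is applied below on \<open>lborel\<close>, so the Gamma integral is turned from a
  gauge integral into a Bochner one. The real integrand with exponent \<open>Re z - 1\<close> is the
  dominating function.\<close>

lemma Gamma_integral_lborel:
  assumes "Re z > 0"
  defines "g \<equiv> (\<lambda>t. indicator {0..} t *\<^sub>R (complex_of_real t powr (z - 1) / of_real (exp t)))"
  shows "integrable lborel g" "integral\<^sup>L lborel g = Gamma z"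
proof -
  have "(\<lambda>t. complex_of_real t powr (z - 1) / of_real (exp t)) absolutely_integrable_on {0..}"
  proof (rule set_integrable_bound)
    show "(\<lambda>t. t powr (Re z - 1) / exp t) absolutely_integrable_on {0..}"
      using Gamma_integral_real[of "Re z"] assms
      by (subst absolutely_integrable_on_iff_nonneg) (auto simp: has_integral_iff)
  qed (auto simp: set_borel_measurable_def norm_divide norm_of_real_powr simp flip: exp_of_real
        intro!: measurable_completion)
  then have *: "set_integrable lebesgue {0..} (\<lambda>t. complex_of_real t powr (z - 1) / of_real (exp t))" .
  have m: "g \<in> borel_measurable lborel"
    unfolding g_def by measurable
  show "integrable lborel g"
    using * m integrable_completion[of g lborel] by (simp add: set_integrable_def g_def)
  have "Gamma z = integral {0..} (\<lambda>t. complex_of_real t powr (z - 1) / of_real (exp t))"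
    using Gamma_integral_complex[OF assms(1)] by (simp add: has_integral_iff)
  also have "\<dots> = integral\<^sup>L lebesgue g"
    using set_lebesgue_integral_eq_integral(2)[OF *] by (simp add: set_lebesgue_integral_def g_def)
  also have "\<dots> = integral\<^sup>L lborel g"
    by (rule integral_completion[OF m])
  finally show "integral\<^sup>L lborel g = Gamma z" ..
qed

text \<open>Integrating the convolution of the two Gamma densities over the half-line in both orders
  gives \<open>\<Gamma>(a) \<Gamma>(b) = B \<Gamma>(a + b)\<close>, where \<open>B\<close> is the integral below.\<close>

theorem Beta_integral_complex:
  assumes a: "Re a > 0" and b: "Re b > 0"
  shows "(LINT t:{0..1}|lborel. complex_of_real t powr (a - 1) * complex_of_real (1 - t) powr (b - 1)) = Beta a b"
    (is "?B = _")
proof -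
  define g where "g = (\<lambda>z t. indicator {0..} t *\<^sub>R (complex_of_real t powr (z - 1) / of_real (exp t)))"
  have g_int: "integrable lborel (g z)" and g_Gamma: "integral\<^sup>L lborel (g z) = Gamma z"
    if "Re z > 0" for z
    using Gamma_integral_lborel[OF that] by (auto simp: g_def)
  have [measurable]: "g z \<in> borel_measurable borel" for z
    unfolding g_def by measurable
  have shift_int: "integrable lborel (\<lambda>u. g b (u - t))" for t
    using lborel_integrable_real_affine[OF g_int[OF b], of 1 "-t"] by simp
  have shift: "(LINT u|lborel. f (u - t)) = integral\<^sup>L lborel f" for t
    and f :: "real \<Rightarrow> 'a::{banach,second_countable_topology}"
    using lborel_integral_real_affine[of 1 f "-t"] by simp
  \<comment> \<open>For \<open>u > 0\<close> the two exponentials combine to \<open>exp u\<close>,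
    independent of \<open>t\<close>, and a scaled Beta integral remains. For \<open>u < 0\<close>
    the two supports are disjoint. The null set \<open>u = 0\<close> is left to the
    almost-everywhere congruence below.\<close>
  have conv: "(LINT t|lborel. g a t * g b (u - t)) = ?B * g (a + b) u" if "u \<noteq> 0" for u
  proof (cases "u > 0")
    case True
    have "(LINT t|lborel. g a t * g b (u - t)) = (LINT t|lborel. (1 / of_real (exp u)) * (indicator {0..u} t *\<^sub>R
            (complex_of_real t powr (a - 1) * complex_of_real (u - t) powr (b - 1))))"
      by (intro Bochner_Integration.integral_cong refl)
         (auto simp: g_def indicator_def exp_diff field_simps)
    also have "\<dots> = (1 / of_real (exp u)) * (of_real u powr (a + b - 1) * ?B)"
      using Beta_integrand_scaled[OF True, of a b]
      by (subst integral_mult_right_zero) (simp add: set_lebesgue_integral_def)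
    also have "\<dots> = ?B * g (a + b) u"
      using True by (simp add: g_def)
    finally show ?thesis .
  next
    case False
    then have "(\<lambda>t. g a t * g b (u - t)) = (\<lambda>t. 0)"
      using that by (auto simp: g_def indicator_def fun_eq_iff)
    then show ?thesis
      using False that by (simp only: integral_zero) (simp add: g_def)
  qed
  have "Gamma a * Gamma b = (LINT t|lborel. g a t * Gamma b)"
    by (simp add: g_Gamma a)
  also have "\<dots> = (LINT t|lborel. LINT u|lborel. g a t * g b (u - t))"
    by (simp add: shift g_Gamma b)
  also have "\<dots> = (LINT u|lborel. LINT t|lborel. g a t * g b (u - t))"
  \<comment> \<open>By translation invariance the inner integral of the modulus is
    \<open>norm (g a t)\<close> times a constant, hence integrable in \<open>t\<close>.\<close>
  proof (rule lborel_pair.Fubini_integral[symmetric], rule lborel_pair.Fubini_integrable)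
    have "(LINT u|lborel. norm (g a t * g b (u - t))) = norm (g a t) * (LINT u|lborel. norm (g b u))" for t
      by (simp add: norm_mult shift[of "\<lambda>u. norm (g b u)"])
    then show "integrable lborel (\<lambda>t. LINT u|lborel. norm (case (t, u) of (t, u) \<Rightarrow> g a t * g b (u - t)))"
      using g_int[OF a] by simp
    show "AE t in lborel. integrable lborel (\<lambda>u. case (t, u) of (t, u) \<Rightarrow> g a t * g b (u - t))"
      by (simp add: shift_int)
  qed measurable
  also have "\<dots> = (LINT u|lborel. ?B * g (a + b) u)"
  proof (rule integral_cong_AE)
    show "AE u in lborel. (LINT t|lborel. g a t * g b (u - t)) = ?B * g (a + b) u"
      using AE_lborel_singleton[of 0] by eventually_elim (rule conv)
  qed measurable
  also have "\<dots> = ?B * Gamma (a + b)"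
    using a b by (simp add: g_Gamma)
  finally show ?thesis
    using a b by (simp add: Beta_def field_simps Gamma_nonzero_of_Re_pos)
qed

text \<open>Triangle inequality for the Beta integral: the modulus of a complex power of a
  nonnegative real is the power with the real part as exponent.\<close>

lemma norm_Beta_complex_le:
  assumes "Re a > 0" "Re b > 0"
  shows "norm (Beta a b) \<le> Beta (Re a) (Re b)"
proof -
  let ?f = "\<lambda>t. complex_of_real t powr (a - 1) * complex_of_real (1 - t) powr (b - 1)"
  have "norm (Beta a b) \<le> (LINT t:{0..1}|lborel. norm (?f t))"
    unfolding Beta_integral_complex[OF assms, symmetric]
    by (rule set_integral_norm_bound[OF Beta_integrand_integrable[OF assms]])
  also have "\<dots> = (LINT t:{0..1}|lborel. t powr (Re a - 1) * (1 - t) powr (Re b - 1))"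
    by (intro set_lebesgue_integral_cong)
       (auto simp: norm_mult norm_of_real_powr simp del: of_real_diff)
  also have "\<dots> = Beta (Re a) (Re b)"
    using set_borel_integral_eq_integral(2)[OF integrable_Beta] has_integral_Beta_real assms
    by (simp add: has_integral_iff)
  finally show ?thesis .
qed


section \<open>Bounds for reciprocal Gamma values\<close>

text \<open>Stirling is not needed for complex arguments: iterating
  \<open>1 / \<Gamma>(z + \<nu>) = B(z, \<nu>) / (\<Gamma>(z) \<Gamma>(\<nu>))\<close> and \<open>|B(z, \<nu>)| \<le> B(Re z, Re \<nu>)\<close> reduces to real ones.\<close>

lemma norm_inverse_Gamma_le:
  fixes \<nu> :: complex and k r :: nat
  assumes "Re \<nu> > 0"
  shows "1 / norm (Gamma (\<nu> * of_nat k + of_nat r + 1)) \<le>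
         (Gamma (Re \<nu>) / norm (Gamma \<nu>)) ^ k / Gamma (Re \<nu> * k + r + 1)"
proof (induction k)
  case 0
  have "Gamma (complex_of_nat r + 1) = of_real (Gamma (real r + 1))"
    by (simp add: Gamma_complex_of_real [symmetric])
  then show ?case by (simp add: Gamma_real_pos less_imp_le)
next
  case (Suc k)
  define z where "z = \<nu> * of_nat k + of_nat r + 1"
  define G where "G = Gamma (Re \<nu>) / norm (Gamma \<nu>)"
  have z: "Re z = Re \<nu> * k + r + 1" "Re z > 0"
    using assms by (simp_all add: z_def add_nonneg_pos)
  have nz: "norm (Gamma z) > 0" "norm (Gamma \<nu>) > 0" "norm (Gamma (z + \<nu>)) > 0"
    using z assms by (simp_all add: Gamma_nonzero_of_Re_pos)
  have pos: "Gamma (Re \<nu>) > 0" "Gamma (Re z) > 0" "Gamma (Re z + Re \<nu>) > 0"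
    using z assms by (simp_all add: Gamma_real_pos)
  have "1 / norm (Gamma (z + \<nu>)) = norm (Beta z \<nu>) * (1 / norm (Gamma z)) / norm (Gamma \<nu>)"
    using nz by (simp add: Beta_def norm_mult norm_divide)
  also have "\<dots> \<le> Beta (Re z) (Re \<nu>) * (G ^ k / Gamma (Re z)) / norm (Gamma \<nu>)"
    using Suc.IH norm_Beta_complex_le[OF z(2) assms] nz pos
    unfolding z(1)[symmetric] z_def[symmetric] G_def[symmetric]
    by (intro divide_right_mono mult_mono) (auto simp: Beta_def)
  also have "\<dots> = G ^ Suc k / Gamma (Re z + Re \<nu>)"
    using nz pos by (simp add: Beta_def G_def field_simps)
  finally show ?case
    by (simp add: G_def z(1)) (simp add: z_def algebra_simps)
qed

text \<open>Only the part of the Gamma integral over \<open>{X..}\<close> is kept, where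
  \<open>t powr x \<ge> X powr x\<close>. The parameter \<open>X\<close> stays free so that it can
  later beat any geometric growth.\<close>

lemma Gamma_real_lower_bound:
  fixes x X :: real
  assumes "x \<ge> 0" "X > 0"
  shows "X powr x * exp (- X) \<le> Gamma (x + 1)"
proof (rule has_integral_le)
  have "((\<lambda>t. X powr x * exp (- t)) has_integral X powr x * exp (- X)) {X..}"
    using has_integral_exp_minus_to_infinity[of 1 X]
    by (intro has_integral_mult_right) simp
  then show "((\<lambda>t. if t \<in> {X..} then X powr x * exp (- t) else 0) has_integral
      X powr x * exp (- X)) {0..}"
    using assms by (subst has_integral_restrict) auto
  show "((\<lambda>t. t powr x / exp t) has_integral Gamma (x + 1)) {0..}"
    using Gamma_integral_real[of "x + 1"] assms by simp
  show "(if t \<in> {X..} then X powr x * exp (- t) else 0) \<le> t powr x / exp t" for t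
    using assms by (auto simp: exp_minus field_simps powr_mono2)
qed

section \<open>Riemann-Liouville integrals of complex order\<close>

text \<open>For Borel functions the completed measure can be replaced by \<open>lborel\<close>,
  where the Beta integral and the affine substitutions are available.\<close>

lemma RL_integrable_lborel_iff:
  assumes [measurable]: "g \<in> borel_measurable borel"
  shows "RL_integrable \<nu> g t \<longleftrightarrow>
    set_integrable lborel {0..t} (\<lambda>\<tau>. of_real (t - \<tau>) powr (\<nu> - 1) * g \<tau>)"
  unfolding RL_integrable_def set_integrable_def
  by (rule integrable_completion) measurable

lemma RL_integral_lborel:
  assumes [measurable]: "g \<in> borel_measurable borel"
  shows "RL_integral \<nu> g t =
    1 / Gamma \<nu> * (LINT \<tau>:{0..t}|lborel. of_real (t - \<tau>) powr (\<nu> - 1) * g \<tau>)"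
  unfolding RL_integral_def set_lebesgue_integral_def
  by (subst integral_completion) (simp_all del: of_real_diff)

lemma RL_integral_cong:
  assumes "\<And>\<tau>. \<tau> \<in> {0..t} \<Longrightarrow> f \<tau> = g \<tau>"
  shows "RL_integral \<nu> f t = RL_integral \<nu> g t"
  unfolding RL_integral_def
  by (intro arg_cong2[of _ _ _ _ "(*)"] refl set_lebesgue_integral_cong) (use assms in auto)

lemma RL_integral_cmult: "RL_integral \<nu> (\<lambda>\<tau>. x * f \<tau>) t = x * RL_integral \<nu> f t"
proof -
  have "(\<lambda>\<tau>. complex_of_real (t - \<tau>) powr (\<nu> - 1) * (x * f \<tau>)) =
        (\<lambda>\<tau>. x * (complex_of_real (t - \<tau>) powr (\<nu> - 1) * f \<tau>))"
    by (simp add: mult_ac)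
  then show ?thesis
    by (simp only: RL_integral_def set_integral_mult_right) simp
qed

text \<open>This is the scaled Beta integral; the factor \<open>Gamma \<nu>\<close> of
  \<open>Beta a \<nu>\<close> cancels the normalisation.\<close>

lemma RL_integral_powr:
  assumes "Re a > 0" "Re \<nu> > 0" "t > 0"
  shows "RL_integral \<nu> (\<lambda>\<tau>. of_real \<tau> powr (a - 1)) t =
         Gamma a / Gamma (a + \<nu>) * of_real t powr (a + \<nu> - 1)"
proof -
  have "RL_integral \<nu> (\<lambda>\<tau>. of_real \<tau> powr (a - 1)) t = 1 / Gamma \<nu> * (of_real t powr (a + \<nu> - 1) * Beta a \<nu>)"
    using Beta_integrand_scaled[OF assms(3), of a \<nu>]
    by (simp add: RL_integral_lborel Beta_integral_complex assms mult.commute del: of_real_diff)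
  also have "\<dots> = Gamma a / Gamma (a + \<nu>) * of_real t powr (a + \<nu> - 1)"
    using assms by (simp add: Beta_def Gamma_nonzero_of_Re_pos)
  finally show ?thesis .
qed

lemma RL_kernel_integrable:
  assumes "Re \<nu> > 0" "t > 0"
  shows "set_integrable lborel {0..t} (\<lambda>\<tau>. complex_of_real (t - \<tau>) powr (\<nu> - 1))"
proof (rule set_integrable_bound)
  let ?h = "\<lambda>\<tau>. indicat_real {0..t} \<tau> *\<^sub>R \<tau> powr (Re \<nu> - 1)"
  have "(\<lambda>\<tau>. \<tau> powr (Re \<nu> - 1)) integrable_on {0..t}"
    using assms by (intro integrable_on_powr_from_0) auto
  then have "(\<lambda>\<tau>. \<tau> powr (Re \<nu> - 1)) absolutely_integrable_on {0..t}"
    by (subst absolutely_integrable_on_iff_nonneg) auto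
  then have "integrable lborel ?h"
    by (simp add: set_integrable_def integrable_completion)
  \<comment> \<open>The reflection \<open>\<tau> \<mapsto> t - \<tau>\<close> carries the
    singularity from \<open>0\<close> to \<open>t\<close>.\<close>
  then have "integrable lborel (\<lambda>\<tau>. ?h (t + (-1) * \<tau>))"
    by (rule lborel_integrable_real_affine) simp
  moreover have "?h (t + (-1) * \<tau>) = indicat_real {0..t} \<tau> *\<^sub>R (t - \<tau>) powr (Re \<nu> - 1)" for \<tau>
    by (auto simp: indicator_def)
  ultimately show "set_integrable lborel {0..t} (\<lambda>\<tau>. (t - \<tau>) powr (Re \<nu> - 1))"
    by (simp only: set_integrable_def)
qed (auto simp: set_borel_measurable_def norm_of_real_powr simp del: of_real_diff)

text \<open>A Weierstrass majorant times the integrable kernel bounds the sum of the integrals of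
  the moduli, so sum and integral may be exchanged.\<close>

lemma RL_suminf:
  fixes f :: "nat \<Rightarrow> real \<Rightarrow> complex"
  assumes "Re \<nu> > 0" "t > 0"
    and [measurable]: "\<And>n. f n \<in> borel_measurable borel"
    and bound: "\<And>n \<tau>. \<tau> \<in> {0..t} \<Longrightarrow> norm (f n \<tau>) \<le> b n"
    and "summable b"
  shows "RL_integrable \<nu> (\<lambda>\<tau>. \<Sum>n. f n \<tau>) t"
    and "(\<lambda>n. RL_integral \<nu> (f n) t) sums RL_integral \<nu> (\<lambda>\<tau>. \<Sum>n. f n \<tau>) t"
proof -
  \<comment> \<open>The cutoff is part of the weight, so the bound on \<open>f n\<close> is needed
    on \<open>{0..t}\<close> only.\<close>
  define w where "w = (\<lambda>\<tau>. indicator {0..t} \<tau> *\<^sub>R complex_of_real (t - \<tau>) powr (\<nu> - 1))"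
  have w: "integrable lborel w"
    using RL_kernel_integrable[OF assms(1,2)] by (simp add: w_def set_integrable_def)
  have w_bound: "norm (w \<tau> * f n \<tau>) \<le> b n * norm (w \<tau>)" for n \<tau>
    using mult_right_mono[OF bound[of \<tau> n] norm_ge_zero[of "w \<tau>"]]
    by (cases "\<tau> \<in> {0..t}") (auto simp: w_def norm_mult mult.commute)
  have [measurable]: "w \<in> borel_measurable borel"
    using borel_measurable_integrable[OF w] by simp
  have b_nonneg: "b n \<ge> 0" for n
    using bound[of 0 n] \<open>t > 0\<close> order_trans[OF norm_ge_zero] by auto
  have int: "integrable lborel (\<lambda>\<tau>. w \<tau> * f n \<tau>)" for n
  proof (rule Bochner_Integration.integrable_bound)
    show "integrable lborel (\<lambda>\<tau>. b n * norm (w \<tau>))"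
      using w by simp
  qed (use w_bound[of _ n] b_nonneg in auto)
  have summ: "AE \<tau> in lborel. summable (\<lambda>n. norm (w \<tau> * f n \<tau>))"
    by (intro AE_I2 summable_comparison_test'[OF summable_mult2[OF \<open>summable b\<close>], of 0])
       (use w_bound in auto)
  have summ_int: "summable (\<lambda>n. LINT \<tau>|lborel. norm (w \<tau> * f n \<tau>))"
  proof (rule summable_comparison_test')
    show "summable (\<lambda>n. b n * (LINT \<tau>|lborel. norm (w \<tau>)))"
      by (intro summable_mult2 \<open>summable b\<close>)
    show "norm (LINT \<tau>|lborel. norm (w \<tau> * f n \<tau>)) \<le> b n * (LINT \<tau>|lborel. norm (w \<tau>))" for n
      using integral_mono[of lborel "\<lambda>\<tau>. norm (w \<tau> * f n \<tau>)" "\<lambda>\<tau>. b n * norm (w \<tau>)"]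
        int[of n] w w_bound[of _ n] by simp
  qed
  have eq: "(\<Sum>n. w \<tau> * f n \<tau>) =
      indicator {0..t} \<tau> *\<^sub>R (complex_of_real (t - \<tau>) powr (\<nu> - 1) * (\<Sum>n. f n \<tau>))" for \<tau>
  proof (cases "\<tau> \<in> {0..t}")
    case True
    have "summable (\<lambda>n. f n \<tau>)"
      using bound[OF True] by (intro summable_comparison_test'[OF \<open>summable b\<close>]) auto
    then show ?thesis
      using True by (simp add: w_def suminf_mult)
  qed (simp add: w_def)
  show "RL_integrable \<nu> (\<lambda>\<tau>. \<Sum>n. f n \<tau>) t"
    using integrable_suminf[OF int summ summ_int] unfolding eq
    by (subst RL_integrable_lborel_iff) (measurable, simp add: set_integrable_def)
  have "(\<lambda>n. LINT \<tau>|lborel. w \<tau> * f n \<tau>) sums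
      (LINT \<tau>:{0..t}|lborel. complex_of_real (t - \<tau>) powr (\<nu> - 1) * (\<Sum>n. f n \<tau>))"
    using sums_integral[OF int summ summ_int] unfolding eq by (simp add: set_lebesgue_integral_def)
  from sums_mult[OF this, of "1 / Gamma \<nu>"]
  show "(\<lambda>n. RL_integral \<nu> (f n) t) sums RL_integral \<nu> (\<lambda>\<tau>. \<Sum>n. f n \<tau>) t"
    by (simp add: RL_integral_lborel set_lebesgue_integral_def w_def scaleR_conv_of_real mult.assoc)
qed

section \<open>The complex Neumann series\<close>

text \<open>The power in front of the Miller-Ross series is moved inside the sum, so that each
  summand is, for \<open>t > 0\<close>, a multiple of one power of \<open>t\<close>.\<close>

definition mr_term :: "complex \<Rightarrow> complex \<Rightarrow> nat \<Rightarrow> nat \<Rightarrow> real \<Rightarrow> complex" where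
  "mr_term \<nu> c k r t =
     of_real t powr (\<nu> * of_nat k) *
       ((c * of_real t) ^ r / Gamma (\<nu> * of_nat k + of_nat r + 1))"

lemma borel_measurable_mr_term [measurable]: "mr_term \<nu> c k r \<in> borel_measurable borel"
  unfolding mr_term_def by measurable

lemma mr_term_0 [simp]: "mr_term \<nu> c k r 0 = 0"
  by (simp add: mr_term_def)

text \<open>The bound holds up to \<open>t = 0\<close> because HOL has \<open>0 powr z = 0\<close>, even for \<open>k = r = 0\<close>.  Its geometric
  decay comes from \<open>1 / \<Gamma>(x + 1) \<le> exp X / X powr x\<close> with \<open>X\<close> chosen large in terms of \<open>T\<close>, \<open>A\<close> and \<open>c\<close>.\<close>

lemma mr_term_bound:
  assumes "Re \<nu> > 0" "T > 0" "A \<ge> 0"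
  obtains M where
    "\<And>k r t. t \<in> {0..T} \<Longrightarrow> A ^ k * norm (mr_term \<nu> c k r t) \<le> M * (1/2) ^ k * (1/2) ^ r"
proof -
  define a where "a = Re \<nu>"
  define G where "G = Gamma (Re \<nu>) / norm (Gamma \<nu>)"
  have a: "a > 0" and G: "G \<ge> 0"
    using assms by (simp_all add: a_def G_def Gamma_real_pos less_imp_le)
  \<comment> \<open>The two expressions are the ratios in \<open>k\<close> and in \<open>r\<close>
    of the final estimate. Both tend to 0 as \<open>X\<close> grows, so one \<open>X\<close> makes
    both smaller than 1/2; then \<open>exp X\<close> serves as \<open>M\<close>.\<close>
  have "((\<lambda>X::real. A * G * T powr a * X powr (- a)) \<longlongrightarrow> A * G * T powr a * 0) at_top"
    using a by (intro tendsto_intros tendsto_neg_powr filterlim_ident) auto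
  moreover have "((\<lambda>X::real. norm c * T * X powr (- 1)) \<longlongrightarrow> norm c * T * 0) at_top"
    by (intro tendsto_intros tendsto_neg_powr filterlim_ident) auto
  ultimately have "\<forall>\<^sub>F X in at_top. A * G * T powr a * X powr (- a) < 1/2 \<and>
      norm c * T * X powr (- 1) < 1/2 \<and> X > 0"
    by (intro eventually_conj eventually_gt_at_top order_tendstoD(2)) auto
  then obtain X where X: "A * G * T powr a * X powr (- a) < 1/2"
      "norm c * T * X powr (- 1) < 1/2" "X > 0"
    by (auto simp: eventually_at_top_linorder)
  have "A ^ k * norm (mr_term \<nu> c k r t) \<le> exp X * (1/2) ^ k * (1/2) ^ r" if t: "t \<in> {0..T}" for k r t
  proof (cases "t = 0")
    case False
    have x: "a * k + r \<ge> 0" using a by simp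
    have "norm (mr_term \<nu> c k r t) =
        t powr (a * k) * (norm c * t) ^ r * (1 / norm (Gamma (\<nu> * of_nat k + of_nat r + 1)))"
      using t by (simp add: mr_term_def norm_mult norm_divide norm_power norm_of_real_powr a_def)
    also have "\<dots> \<le> T powr (a * k) * (norm c * T) ^ r * (G ^ k / Gamma (a * k + r + 1))"
      using t a norm_inverse_Gamma_le[OF assms(1), of k r]
      by (intro mult_mono powr_mono2 power_mono mult_left_mono) (auto simp: a_def G_def)
    also have "\<dots> \<le> T powr (a * k) * (norm c * T) ^ r * (G ^ k / (X powr (a * k + r) * exp (- X)))"
      using Gamma_real_lower_bound[OF x \<open>X > 0\<close>] G \<open>T > 0\<close> \<open>X > 0\<close>
      by (intro mult_left_mono divide_left_mono mult_pos_pos) (use Gamma_real_pos[of "a * k + r + 1"] x in auto)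
    also have "\<dots> = exp X * (G * T powr a * X powr (- a)) ^ k * (norm c * T * X powr (- 1)) ^ r"
      using \<open>X > 0\<close> \<open>T > 0\<close>
      by (simp add: power_mult_distrib powr_powr powr_minus powr_add exp_minus field_simps
          flip: powr_realpow)
    finally have "A ^ k * norm (mr_term \<nu> c k r t) \<le>
        A ^ k * (exp X * (G * T powr a * X powr (- a)) ^ k * (norm c * T * X powr (- 1)) ^ r)"
      using assms by (intro mult_left_mono) auto
    also have "\<dots> = exp X * (A * G * T powr a * X powr (- a)) ^ k * (norm c * T * X powr (- 1)) ^ r"
      by (simp add: power_mult_distrib mult_ac)
    also have "\<dots> \<le> exp X * (1/2) ^ k * (1/2) ^ r"
      using X assms G by (intro mult_mono power_mono) auto
    finally show ?thesis .
  qed simp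
  then show ?thesis by (rule that)
qed

text \<open>With \<open>z = \<nu> k + r + 1\<close> the term is a multiple of
  \<open>\<tau> powr (z - 1) / Gamma z\<close>. Integration turns \<open>z\<close> into
  \<open>z + \<nu>\<close>, which is the value of \<open>z\<close> for \<open>k + 1\<close>.\<close>

lemma RL_integral_mr_term:
  assumes "Re \<nu> > 0" "t > 0"
  shows "RL_integral \<nu> (mr_term \<nu> c k r) t = mr_term \<nu> c (Suc k) r t"
proof -
  define z where "z = \<nu> * of_nat k + of_nat r + 1"
  have z: "Re z > 0"
    using assms by (simp add: z_def add_nonneg_pos)
  have pow: "complex_of_real s powr (w + of_nat r) = of_real s powr w * of_real s ^ r"
    if "s > 0" for s w
    using that by (simp add: powr_add powr_nat')
  have "RL_integral \<nu> (mr_term \<nu> c k r) t =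
      RL_integral \<nu> (\<lambda>\<tau>. (c ^ r / Gamma z) * of_real \<tau> powr (z - 1)) t"
  proof (rule RL_integral_cong)
    fix \<tau> assume "\<tau> \<in> {0..t}"
    then show "mr_term \<nu> c k r \<tau> = (c ^ r / Gamma z) * of_real \<tau> powr (z - 1)"
      \<comment> \<open>At \<open>\<tau> = 0\<close> both sides vanish by
        \<open>0 powr z = 0\<close>; for \<open>\<tau> > 0\<close> the integer part \<open>r\<close>
        of the exponent splits off as an ordinary power.\<close>
      by (cases "\<tau> = 0") (auto simp: mr_term_def z_def pow power_mult_distrib)
  qed
  also have "\<dots> = c ^ r / Gamma z * (Gamma z / Gamma (z + \<nu>) * of_real t powr (z + \<nu> - 1))"
    by (simp only: RL_integral_cmult RL_integral_powr[OF z assms])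
  also have "\<dots> = c ^ r / Gamma (z + \<nu>) * of_real t powr (z + \<nu> - 1)"
    using Gamma_nonzero_of_Re_pos[OF z] by simp
  also have "z + \<nu> - 1 = \<nu> * of_nat (Suc k) + of_nat r"
    by (simp add: z_def algebra_simps)
  also have "z + \<nu> = \<nu> * of_nat (Suc k) + of_nat r + 1"
    by (simp add: z_def algebra_simps)
  also have "c ^ r / Gamma (\<nu> * of_nat (Suc k) + of_nat r + 1) *
      of_real t powr (\<nu> * of_nat (Suc k) + of_nat r) = mr_term \<nu> c (Suc k) r t"
    unfolding pow[OF assms(2)] by (simp add: mr_term_def power_mult_distrib)
  finally show ?thesis .
qed

text \<open>One idempotent component of \<open>miller_ross (V * of_nat k) C\<close> at a real
  argument \<open>t \<ge> 0\<close>.\<close>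

definition mr_fun :: "complex \<Rightarrow> complex \<Rightarrow> nat \<Rightarrow> real \<Rightarrow> complex" where
  "mr_fun \<nu> c k t = (\<Sum>r. mr_term \<nu> c k r t)"

lemma borel_measurable_mr_fun [measurable]: "mr_fun \<nu> c k \<in> borel_measurable borel"
  unfolding mr_fun_def by measurable

lemma summable_half_powers: "summable (\<lambda>r. M * (1/2::real) ^ r)"
  by (intro summable_mult summable_geometric) simp

lemma suminf_half_powers: "(\<Sum>r. M * (1/2::real) ^ r) = M * 2"
  by (subst suminf_mult) (simp_all add: suminf_geometric)

lemma mr_term_bound_fixed:
  assumes "Re \<nu> > 0" "T > 0"
  obtains M where "\<And>r t. t \<in> {0..T} \<Longrightarrow> norm (mr_term \<nu> c k r t) \<le> M * (1/2) ^ r"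
proof -
  obtain M where M: "\<And>k r t. t \<in> {0..T} \<Longrightarrow> 1 ^ k * norm (mr_term \<nu> c k r t) \<le> M * (1/2) ^ k * (1/2) ^ r"
    using mr_term_bound[OF assms, of 1] by auto
  show ?thesis
    by (rule that[of "M * (1/2) ^ k"]) (use M[of _ k] in auto)
qed

lemma summable_mr_term:
  assumes "Re \<nu> > 0" "t \<ge> 0"
  shows "summable (\<lambda>r. mr_term \<nu> c k r t)"
proof (cases "t = 0")
  case False
  then have "t > 0" using assms by simp
  then obtain M where "\<And>r. norm (mr_term \<nu> c k r t) \<le> M * (1/2) ^ r"
    using mr_term_bound_fixed[OF assms(1), of t c k] by (metis atLeastAtMost_iff order_refl assms(2))
  then show ?thesis
    by (intro summable_comparison_test'[OF summable_half_powers])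
qed simp

lemma RL_integral_mr_fun:
  assumes "Re \<nu> > 0" "t > 0"
  shows "RL_integral \<nu> (mr_fun \<nu> c k) t = mr_fun \<nu> c (Suc k) t"
proof -
  obtain M where "\<And>r s. s \<in> {0..t} \<Longrightarrow> norm (mr_term \<nu> c k r s) \<le> M * (1/2) ^ r"
    using mr_term_bound_fixed[OF assms, of c k] by blast
  then have "(\<lambda>r. RL_integral \<nu> (mr_term \<nu> c k r) t) sums RL_integral \<nu> (\<lambda>s. \<Sum>r. mr_term \<nu> c k r s) t"
    by (intro RL_suminf(2)[OF assms _ _ summable_half_powers]) auto
  then show ?thesis
    by (simp add: RL_integral_mr_term assms sums_iff mr_fun_def[abs_def])
qed

text \<open>For \<open>k = 0\<close> the Gamma values are factorials and the series is the
  exponential one. At \<open>t = 0\<close> this would fail, as \<open>0 powr 0 = 0\<close>.\<close>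

lemma mr_fun_first:
  assumes "t > 0"
  shows "mr_fun \<nu> c 0 t = exp (c * of_real t)"
proof -
  have "Gamma (complex_of_nat r + 1) = fact r" for r
    by (metis Gamma_fact add.commute)
  then show ?thesis
    using assms by (simp add: mr_fun_def mr_term_def exp_def scaleR_conv_of_real divide_inverse mult.commute)
qed

text \<open>Here \<open>c\<close> is a component of \<open>C\<close>, while \<open>\<kappa>\<close>
  stands for a component of the power \<open>bc_powr (of_real c) V\<close> of the real coefficient
  in the equation.\<close>

definition frac_sol :: "complex \<Rightarrow> complex \<Rightarrow> complex \<Rightarrow> complex \<Rightarrow> real \<Rightarrow> complex" where
  "frac_sol \<nu> c \<kappa> n0 t = (\<Sum>k. n0 * (- \<kappa>) ^ k * mr_fun \<nu> c k t)"

lemma borel_measurable_frac_sol [measurable]: "frac_sol \<nu> c \<kappa> n0 \<in> borel_measurable borel"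
  unfolding frac_sol_def by measurable

text \<open>Taking \<open>A = norm \<kappa>\<close> absorbs the growth of
  \<open>\<kappa> ^ k\<close>; summing the geometric series over \<open>r\<close> costs a factor
  2.\<close>

lemma frac_sol_term_bound:
  assumes "Re \<nu> > 0" "T > 0"
  obtains M where "\<And>k t. t \<in> {0..T} \<Longrightarrow> norm (n0 * (- \<kappa>) ^ k * mr_fun \<nu> c k t) \<le> M * (1/2) ^ k"
proof -
  obtain M where M: "\<And>k r t. t \<in> {0..T} \<Longrightarrow>
      norm \<kappa> ^ k * norm (mr_term \<nu> c k r t) \<le> M * (1/2) ^ k * (1/2) ^ r"
    using mr_term_bound[OF assms, of "norm \<kappa>"] by auto
  have "norm (n0 * (- \<kappa>) ^ k * mr_fun \<nu> c k t) \<le> (norm n0 * M * 2) * (1/2) ^ k"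
    if t: "t \<in> {0..T}" for k t
  proof -
    have "(\<Sum>r. (- \<kappa>) ^ k * mr_term \<nu> c k r t) = (- \<kappa>) ^ k * mr_fun \<nu> c k t"
      unfolding mr_fun_def using t by (intro suminf_mult summable_mr_term assms) auto
    moreover have "norm (\<Sum>r. (- \<kappa>) ^ k * mr_term \<nu> c k r t) \<le> (\<Sum>r. M * (1/2) ^ k * (1/2) ^ r)"
      using M[OF t] by (intro norm_suminf_le summable_half_powers) (auto simp: norm_mult norm_power)
    ultimately have "norm ((- \<kappa>) ^ k * mr_fun \<nu> c k t) \<le> M * (1/2) ^ k * 2"
      by (simp only: suminf_half_powers)
    from mult_left_mono[OF this norm_ge_zero[of n0]] show ?thesis
      by (simp add: norm_mult mult_ac)
  qed
  then show ?thesis by (rule that)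
qed

lemma summable_frac_sol:
  assumes "Re \<nu> > 0" "t \<ge> 0"
  shows "summable (\<lambda>k. n0 * (- \<kappa>) ^ k * mr_fun \<nu> c k t)"
proof (cases "t = 0")
  case False
  then have "t > 0" using assms by simp
  then obtain M where "\<And>k. norm (n0 * (- \<kappa>) ^ k * mr_fun \<nu> c k t) \<le> M * (1/2) ^ k"
    using frac_sol_term_bound[OF assms(1), of t n0 \<kappa> c]
    by (metis atLeastAtMost_iff order_refl assms(2))
  then show ?thesis
    by (intro summable_comparison_test'[OF summable_half_powers])
qed (simp add: mr_fun_def)

lemma frac_sol_absolutely_integrable:
  assumes "Re \<nu> > 0" "T > 0"
  shows "frac_sol \<nu> c \<kappa> n0 absolutely_integrable_on {0..T}"
proof -
  obtain M where M: "\<And>k t. t \<in> {0..T} \<Longrightarrow> norm (n0 * (- \<kappa>) ^ k * mr_fun \<nu> c k t) \<le> M * (1/2) ^ k"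
    using frac_sol_term_bound[OF assms, of n0 \<kappa> c] by blast
  have bound: "norm (frac_sol \<nu> c \<kappa> n0 t) \<le> M * 2" if "t \<in> {0..T}" for t
    unfolding frac_sol_def suminf_half_powers[symmetric]
    by (intro norm_suminf_le summable_half_powers M that)
  show ?thesis
  proof (rule set_integrable_bound)
    show "(\<lambda>t. M * 2) absolutely_integrable_on {0..T}"
      by (rule absolutely_integrable_on_const) auto
  qed (use order_trans[OF bound abs_ge_self] in \<open>auto simp: set_borel_measurable_def intro!: measurable_completion\<close>)
qed

text \<open>Termwise integration raises \<open>k\<close> by one and the factor
  \<open>- \<kappa>\<close> raises the exponent of the coefficient to match. The result is the same
  series without its term \<open>k = 0\<close>, which is \<open>n0 * exp (c * t)\<close>.\<close>

lemma frac_sol_solves: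
  assumes "Re \<nu> > 0" "t > 0"
  shows "RL_integrable \<nu> (frac_sol \<nu> c \<kappa> n0) t"
    and "frac_sol \<nu> c \<kappa> n0 t - n0 * exp (c * of_real t) = - \<kappa> * RL_integral \<nu> (frac_sol \<nu> c \<kappa> n0) t"
proof -
  obtain M where M: "\<And>k s. s \<in> {0..t} \<Longrightarrow> norm (n0 * (- \<kappa>) ^ k * mr_fun \<nu> c k s) \<le> M * (1/2) ^ k"
    using frac_sol_term_bound[OF assms, of n0 \<kappa> c] by blast
  show "RL_integrable \<nu> (frac_sol \<nu> c \<kappa> n0) t"
    unfolding frac_sol_def[abs_def]
    by (rule RL_suminf(1)[OF assms _ M summable_half_powers]) auto
  have "(\<lambda>k. RL_integral \<nu> (\<lambda>s. n0 * (- \<kappa>) ^ k * mr_fun \<nu> c k s) t) sums RL_integral \<nu> (frac_sol \<nu> c \<kappa> n0) t"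
    unfolding frac_sol_def[abs_def]
    by (rule RL_suminf(2)[OF assms _ M summable_half_powers]) auto
  then have "(\<lambda>k. n0 * (- \<kappa>) ^ k * mr_fun \<nu> c (Suc k) t) sums RL_integral \<nu> (frac_sol \<nu> c \<kappa> n0) t"
    by (simp only: RL_integral_cmult RL_integral_mr_fun[OF assms])
  from sums_mult[OF this, of "- \<kappa>"]
  have "(\<lambda>k. n0 * (- \<kappa>) ^ Suc k * mr_fun \<nu> c (Suc k) t) sums (- \<kappa> * RL_integral \<nu> (frac_sol \<nu> c \<kappa> n0) t)"
    by (simp add: mult_ac)
  then have "(\<lambda>k. n0 * (- \<kappa>) ^ k * mr_fun \<nu> c k t) sums
      (- \<kappa> * RL_integral \<nu> (frac_sol \<nu> c \<kappa> n0) t + n0 * (- \<kappa>) ^ 0 * mr_fun \<nu> c 0 t)"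
    by (rule sums_Suc)
  then show "frac_sol \<nu> c \<kappa> n0 t - n0 * exp (c * of_real t) = - \<kappa> * RL_integral \<nu> (frac_sol \<nu> c \<kappa> n0) t"
    using assms(2) by (simp add: frac_sol_def sums_iff mr_fun_first)
qed

section \<open>Uniqueness\<close>

text \<open>The Gamma integral after the substitution of \<open>l * s\<close>. It is stated for
  nonnegative integrals, whose order is exchanged in the next proof.\<close>

lemma nn_integral_exp_powr:
  fixes a l :: real
  assumes "a > 0" "l > 0"
  shows "(\<integral>\<^sup>+s. ennreal (indicator {0..} s * s powr (a - 1) * exp (- l * s)) \<partial>lborel) =
         ennreal (Gamma a * l powr (- a))"
proof -
  let ?F = "\<lambda>t. ennreal (indicator {0..} t * t powr (a - 1) / exp t)"
  have "ennreal (Gamma a) = ennreal l * (\<integral>\<^sup>+s. ?F (l * s) \<partial>lborel)"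
    using nn_integral_real_affine[of ?F l 0] assms by (simp add: Gamma_conv_nn_integral_real)
  also have "(\<lambda>s. ?F (l * s)) = (\<lambda>s. ennreal (l powr (a - 1)) * ennreal (indicator {0..} s * s powr (a - 1) * exp (- l * s)))"
    using assms by (auto simp: fun_eq_iff indicator_def powr_mult exp_minus divide_inverse zero_le_mult_iff mult_ac
        simp flip: ennreal_mult')
  \<comment> \<open>Multiplying by \<open>l powr (- a)\<close> makes the factor on the right equal
    to 1 and avoids a division in \<open>ennreal\<close>.\<close>
  finally have "ennreal (l powr (- a)) * ennreal (Gamma a) = ennreal (l powr (- a) * l * l powr (a - 1)) *
      (\<integral>\<^sup>+s. ennreal (indicator {0..} s * s powr (a - 1) * exp (- l * s)) \<partial>lborel)"
    using assms by (simp add: nn_integral_cmult ennreal_mult mult.assoc)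
  also have "l powr (- a) * l * l powr (a - 1) = l powr (- a) * l powr 1 * l powr (a - 1)"
    using assms by simp
  also have "\<dots> = 1"
    using assms by (simp only: powr_add [symmetric]) simp
  finally show ?thesis
    using assms by (simp add: ennreal_mult' mult.commute)
qed

text \<open>The proof integrates against \<open>exp(- l t)\<close>: convolution with \<open>s powr (a - 1) * exp(- l s)\<close> has norm
  \<open>\<Gamma>(a) / l powr a\<close>, which makes the factor \<open>K \<Gamma>(a) / l powr a\<close> less than 1 for large \<open>l\<close>.\<close>

lemma Volterra_inequality_AE_zero:
  fixes m :: "real \<Rightarrow> real"
  assumes [measurable]: "m \<in> borel_measurable borel"
    and nonneg: "\<And>t. m t \<ge> 0" and supp: "\<And>t. t \<notin> {0..T} \<Longrightarrow> m t = 0"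
    and int: "(\<integral>\<^sup>+t. ennreal (m t) \<partial>lborel) < \<infinity>"
    and a: "a > 0" and K: "K \<ge> 0"
    and le: "AE t in lborel. ennreal (m t) \<le>
       ennreal K * (\<integral>\<^sup>+\<tau>. ennreal (indicator {0..} (t - \<tau>) * (t - \<tau>) powr (a - 1) * m \<tau>) \<partial>lborel)"
  shows "AE t in lborel. m t = 0"
proof -
  have "((\<lambda>l. K * Gamma a * l powr (- a)) \<longlongrightarrow> K * Gamma a * 0) at_top"
    using a by (intro tendsto_intros tendsto_neg_powr filterlim_ident) auto
  then have "\<forall>\<^sub>F l in at_top. K * Gamma a * l powr (- a) < 1/2 \<and> l > 0"
    by (intro eventually_conj eventually_gt_at_top order_tendstoD(2)) auto
  then obtain l where l: "K * Gamma a * l powr (- a) < 1/2" "l > 0"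
    by (auto simp: eventually_at_top_linorder)
  define q where "q = K * Gamma a * l powr (- a)"
  have q: "0 \<le> q" "q < 1"
    using l K a by (simp_all add: q_def Gamma_real_pos less_imp_le)
  define h where "h = (\<lambda>s. indicator {0..} s * s powr (a - 1) :: real)"
  have h: "h s \<ge> 0" for s by (simp add: h_def)
  have [measurable]: "h \<in> borel_measurable borel" unfolding h_def by measurable
  define I where "I = (\<integral>\<^sup>+t. ennreal (exp (- l * t) * m t) \<partial>lborel)"
  have "I \<le> (\<integral>\<^sup>+t. ennreal (m t) \<partial>lborel)"
    unfolding I_def
  proof (intro nn_integral_mono ennreal_leI)
    fix t show "exp (- l * t) * m t \<le> m t"
      \<comment> \<open>The weight exceeds 1 only for \<open>t < 0\<close>, where \<open>m\<close>
        vanishes. The resulting finiteness of \<open>I\<close> is what lets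
        \<open>I \<le> q * I\<close> force \<open>I = 0\<close>.\<close>
      using supp[of t] nonneg[of t] l by (cases "t \<in> {0..T}") (auto intro: mult_left_le_one_le)
  qed
  from this int have I: "I < \<infinity>" by (rule le_less_trans)
  have inner: "(\<integral>\<^sup>+t. ennreal (exp (- l * t) * (h (t - \<tau>) * m \<tau>)) \<partial>lborel) =
      ennreal (Gamma a * l powr (- a)) * ennreal (exp (- l * \<tau>) * m \<tau>)" for \<tau>
  proof -
    have exp_split: "exp (- (l * (\<tau> + s))) = exp (- (l * s)) * exp (- (l * \<tau>))" for s
      by (simp add: algebra_simps flip: exp_add)
    \<comment> \<open>With \<open>t = \<tau> + s\<close> the exponential weight factors into one
      part for the kernel and one for \<open>m\<close>.\<close>
    have "(\<integral>\<^sup>+t. ennreal (exp (- l * t) * (h (t - \<tau>) * m \<tau>)) \<partial>lborel) =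
        (\<integral>\<^sup>+s. ennreal (exp (- l * (\<tau> + s)) * (h s * m \<tau>)) \<partial>lborel)"
      by (subst nn_integral_real_affine[where c = 1 and t = \<tau>]) simp_all
    also have "\<dots> = (\<integral>\<^sup>+s. ennreal (h s * exp (- l * s)) * ennreal (exp (- l * \<tau>) * m \<tau>) \<partial>lborel)"
      using h nonneg by (simp add: exp_split mult_ac flip: ennreal_mult')
    also have "\<dots> = ennreal (Gamma a * l powr (- a)) * ennreal (exp (- l * \<tau>) * m \<tau>)"
      using nn_integral_exp_powr[OF a l(2)] by (simp add: nn_integral_multc h_def)
    finally show ?thesis .
  qed
  have "I \<le> (\<integral>\<^sup>+t. ennreal K * (\<integral>\<^sup>+\<tau>. ennreal (exp (- l * t) * (h (t - \<tau>) * m \<tau>)) \<partial>lborel) \<partial>lborel)"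
    unfolding I_def
  proof (rule nn_integral_mono_AE)
    show "AE t in lborel. ennreal (exp (- l * t) * m t) \<le>
        ennreal K * (\<integral>\<^sup>+\<tau>. ennreal (exp (- l * t) * (h (t - \<tau>) * m \<tau>)) \<partial>lborel)"
      using le
    proof eventually_elim
      fix t
      assume "ennreal (m t) \<le>
       ennreal K * (\<integral>\<^sup>+\<tau>. ennreal (indicator {0..} (t - \<tau>) * (t - \<tau>) powr (a - 1) * m \<tau>) \<partial>lborel)"
      then have "ennreal (m t) \<le> ennreal K * (\<integral>\<^sup>+\<tau>. ennreal (h (t - \<tau>) * m \<tau>) \<partial>lborel)"
        by (simp add: h_def)
      moreover have "(\<integral>\<^sup>+\<tau>. ennreal (exp (- l * t) * (h (t - \<tau>) * m \<tau>)) \<partial>lborel) =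
          ennreal (exp (- l * t)) * (\<integral>\<^sup>+\<tau>. ennreal (h (t - \<tau>) * m \<tau>) \<partial>lborel)"
        by (subst nn_integral_cmult[symmetric]) (simp_all add: ennreal_mult')
      moreover note mult_left_mono[OF calculation(1), of "ennreal (exp (- l * t))"]
      ultimately
      show "ennreal (exp (- l * t) * m t) \<le>
        ennreal K * (\<integral>\<^sup>+\<tau>. ennreal (exp (- l * t) * (h (t - \<tau>) * m \<tau>)) \<partial>lborel)"
        by (simp add: ennreal_mult'' mult_ac)
    qed
  qed
  also have "\<dots> = ennreal K * (\<integral>\<^sup>+t. \<integral>\<^sup>+\<tau>. ennreal (exp (- l * t) * (h (t - \<tau>) * m \<tau>)) \<partial>lborel \<partial>lborel)"
    by (rule nn_integral_cmult) measurable
  also have "(\<integral>\<^sup>+t. \<integral>\<^sup>+\<tau>. ennreal (exp (- l * t) * (h (t - \<tau>) * m \<tau>)) \<partial>lborel \<partial>lborel) =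
      (\<integral>\<^sup>+\<tau>. \<integral>\<^sup>+t. ennreal (exp (- l * t) * (h (t - \<tau>) * m \<tau>)) \<partial>lborel \<partial>lborel)"
    by (rule lborel_pair.Fubini') measurable
  also have "\<dots> = ennreal (Gamma a * l powr (- a)) * I"
    unfolding inner I_def by (rule nn_integral_cmult) measurable
  also have "ennreal K * (ennreal (Gamma a * l powr (- a)) * I) = ennreal q * I"
    using K by (simp add: q_def ennreal_mult' mult.assoc)
  finally have "I \<le> ennreal q * I" .
  moreover obtain i where i: "I = ennreal i" "i \<ge> 0"
    using I by (cases I) auto
  ultimately have "i \<le> q * i"
    using q by (simp flip: ennreal_mult)
  then have "(1 - q) * i \<le> 0" by (simp add: algebra_simps)
  with q i have "I = 0" by (simp add: mult_le_0_iff)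
  then have "AE t in lborel. ennreal (exp (- l * t) * m t) = 0"
    unfolding I_def by (subst (asm) nn_integral_0_iff_AE) auto
  then show ?thesis
  proof eventually_elim
    fix t assume "ennreal (exp (- l * t) * m t) = 0"
    then show "m t = 0" using nonneg[of t] by (simp add: ennreal_eq_0_iff mult_le_0_iff)
  qed
qed

text \<open>Taking moduli in the equation gives a Volterra inequality for \<open>norm (M t)\<close>
  with the kernel of order \<open>Re \<nu>\<close> and the constant \<open>K\<close> below.\<close>

lemma RL_homogeneous_unique:
  fixes M :: "real \<Rightarrow> complex"
  assumes \<nu>: "Re \<nu> > 0" and T: "T > 0"
    and int: "M absolutely_integrable_on {0..T}"
    and RL: "\<And>t. 0 < t \<Longrightarrow> t \<le> T \<Longrightarrow> RL_integrable \<nu> M t"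
    and eq: "\<And>t. 0 < t \<Longrightarrow> t \<le> T \<Longrightarrow> M t = - \<kappa> * RL_integral \<nu> M t"
  shows "M T = 0"
proof -
  define m0 where "m0 = (\<lambda>t. indicator {0..T} t * norm (M t))"
  have m0_meas: "m0 \<in> borel_measurable lebesgue" and m0_int: "integrable lebesgue m0"
    using integrable_norm[OF int[unfolded set_integrable_def]] by (simp_all add: m0_def)
  \<comment> \<open>\<open>M\<close> is only Lebesgue measurable, whereas the Volterra inequality is
    proved for Borel functions, so the modulus is replaced by a Borel representative.\<close>
  obtain m1 where m1[measurable]: "m1 \<in> borel_measurable lborel" and m1_eq: "AE t in lborel. m0 t = m1 t"
    using completion_ex_borel_measurable_real[OF m0_meas] by blast
  \<comment> \<open>The absolute value and the cutoff make nonnegativity and support hold at every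
    point, not just almost everywhere.\<close>
  define m where "m = (\<lambda>t. indicator {0..T} t * \<bar>m1 t\<bar>)"
  have m[measurable]: "m \<in> borel_measurable borel"
    using m1 unfolding m_def by simp
  have m_eq: "AE t in lborel. m t = m0 t"
    using m1_eq by eventually_elim (auto simp: m_def m0_def indicator_def abs_of_nonneg split: if_splits, metis abs_norm_cancel)
  have m_eq': "AE t in lebesgue. m t = m0 t"
    by (rule AE_completion[OF m_eq])
  define K where "K = norm \<kappa> / norm (Gamma \<nu>)"
  have AE0: "AE t in lborel. m t = 0"
  proof (rule Volterra_inequality_AE_zero[OF m, where T = T and a = "Re \<nu>" and K = K])
    have "(\<integral>\<^sup>+t. ennreal (m t) \<partial>lborel) = (\<integral>\<^sup>+t. ennreal (m0 t) \<partial>lebesgue)"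
      unfolding nn_integral_completion using m_eq by (intro nn_integral_cong_AE) auto
    also have "\<dots> = ennreal (integral\<^sup>L lebesgue m0)"
      by (intro nn_integral_eq_integral m0_int) (simp add: m0_def)
    finally show "(\<integral>\<^sup>+t. ennreal (m t) \<partial>lborel) < \<infinity>" by simp
    show "AE t in lborel. ennreal (m t) \<le> ennreal K *
       (\<integral>\<^sup>+\<tau>. ennreal (indicator {0..} (t - \<tau>) * (t - \<tau>) powr (Re \<nu> - 1) * m \<tau>) \<partial>lborel)"
      \<comment> \<open>The equation is available for \<open>t > 0\<close> only, so the point 0 is
        discarded.\<close>
      using m_eq AE_lborel_singleton[of 0]
    proof eventually_elim
      fix t assume mt: "m t = m0 t" and "t \<noteq> 0"
      show "ennreal (m t) \<le> ennreal K *
         (\<integral>\<^sup>+\<tau>. ennreal (indicator {0..} (t - \<tau>) * (t - \<tau>) powr (Re \<nu> - 1) * m \<tau>) \<partial>lborel)"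
      proof (cases "t \<in> {0..T}")
        case True
        with \<open>t \<noteq> 0\<close> have t: "0 < t" "t \<le> T" by auto
        let ?w = "\<lambda>\<tau>. indicator {0..t} \<tau> *\<^sub>R (complex_of_real (t - \<tau>) powr (\<nu> - 1) * M \<tau>)"
        have "norm (M t) = K * norm (integral\<^sup>L lebesgue ?w)"
          by (subst eq[OF t])
             (simp add: RL_integral_def K_def norm_mult norm_divide set_lebesgue_integral_def)
        then have "ennreal (m t) = ennreal K * ennreal (norm (integral\<^sup>L lebesgue ?w))"
          using True by (simp add: mt m0_def K_def flip: ennreal_mult)
        also have "ennreal (norm (integral\<^sup>L lebesgue ?w)) \<le> (\<integral>\<^sup>+\<tau>. ennreal (norm (?w \<tau>)) \<partial>lebesgue)"
          using RL[OF t] unfolding RL_integrable_def set_integrable_def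
          by (rule integral_norm_bound_ennreal)
        also have "\<dots> = (\<integral>\<^sup>+\<tau>. ennreal (indicator {0..} (t - \<tau>) * (t - \<tau>) powr (Re \<nu> - 1) * m \<tau>) \<partial>lebesgue)"
          using m_eq'
        proof (intro nn_integral_cong_AE, eventually_elim)
          fix \<tau> assume "m \<tau> = m0 \<tau>"
          then show "ennreal (norm (?w \<tau>)) =
              ennreal (indicator {0..} (t - \<tau>) * (t - \<tau>) powr (Re \<nu> - 1) * m \<tau>)"
            \<comment> \<open>The cutoff to \<open>{0..t}\<close> arises from the indicator, which
              gives \<open>\<tau> \<le> t\<close>, and from the support of \<open>m0\<close>, which
              gives \<open>0 \<le> \<tau>\<close>.\<close>
            using t by (auto simp: m0_def indicator_def norm_mult norm_of_real_powr simp del: of_real_diff)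
        qed
        finally show ?thesis
          by (simp add: nn_integral_completion mult_left_mono)
      qed (simp add: m_def)
    qed
  qed (use \<nu> in \<open>auto simp: m_def K_def\<close>)
  have "AE t in lebesgue. m0 t = 0"
    using AE_completion[OF AE0] m_eq' by eventually_elim simp
  then have "AE \<tau> in lebesgue. indicator {0..T} \<tau> *\<^sub>R (complex_of_real (T - \<tau>) powr (\<nu> - 1) * M \<tau>) = 0"
    by eventually_elim (auto simp: m0_def indicator_def)
  then have "RL_integral \<nu> M T = 0"
    by (simp add: RL_integral_def set_lebesgue_integral_def integral_eq_zero_AE)
  then show ?thesis using eq[of T] T by simp
qed

text \<open>In the difference from \<open>frac_sol\<close> the exponential terms cancel, so it
  solves the homogeneous equation.\<close>

lemma frac_sol_unique:
  assumes \<nu>: "Re \<nu> > 0" and T: "T > 0"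
    and int: "f absolutely_integrable_on {0..T}"
    and RL: "\<And>t. t > 0 \<Longrightarrow> RL_integrable \<nu> f t"
    and eq: "\<And>t. t > 0 \<Longrightarrow> f t - n0 * exp (c * of_real t) = - \<kappa> * RL_integral \<nu> f t"
  shows "f T = frac_sol \<nu> c \<kappa> n0 T"
proof -
  let ?g = "frac_sol \<nu> c \<kappa> n0"
  have diff: "RL_integrable \<nu> (\<lambda>\<tau>. f \<tau> - ?g \<tau>) t"
      "RL_integral \<nu> (\<lambda>\<tau>. f \<tau> - ?g \<tau>) t = RL_integral \<nu> f t - RL_integral \<nu> ?g t" if "t > 0" for t
    using set_integral_diff[OF RL[OF that, unfolded RL_integrable_def]
        frac_sol_solves(1)[OF \<nu> that, of c \<kappa> n0, unfolded RL_integrable_def]]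
    by (simp_all add: RL_integrable_def RL_integral_def right_diff_distrib)
  have "f T - ?g T = 0"
  proof (rule RL_homogeneous_unique[OF \<nu> T])
    show "(\<lambda>\<tau>. f \<tau> - ?g \<tau>) absolutely_integrable_on {0..T}"
      using int frac_sol_absolutely_integrable[OF \<nu> T] by (rule set_integral_diff(1))
    show "f t - ?g t = - \<kappa> * RL_integral \<nu> (\<lambda>\<tau>. f \<tau> - ?g \<tau>) t" if "t > 0" for t
      using eq[OF that] frac_sol_solves(2)[OF \<nu> that, of c \<kappa> n0]
      by (simp add: diff that algebra_simps)
  qed (rule diff)
  then show ?thesis by simp
qed

section \<open>Passage to idempotent components\<close>

lemma bounded_linear_idem: "bounded_linear idem1" "bounded_linear idem2"
  by (auto simp: idem1_def idem2_def scaleR_conv_of_real algebra_simps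
      intro!: linear_conv_bounded_linear[THEN iffD1] linearI)

lemma bounded_linear_of_idem:
  "bounded_linear (\<lambda>z. of_idem z 0)" "bounded_linear (\<lambda>z. of_idem 0 z)"
  using bounded_linear_idem[THEN bounded_linear.linear, THEN linear_scale]
  by (auto simp: bc_idem_eq_iff intro!: linear_conv_bounded_linear[THEN iffD1] linearI)

lemma of_idem_split: "of_idem (idem1 Z) 0 + of_idem 0 (idem2 Z) = Z"
  by (simp add: bc_idem_eq_iff)

text \<open>The projections are continuous, and so are the embeddings of the two components, which
  recombine to the original series. Letting \<open>P\<close> range over both projections states each
  fact once.\<close>

lemma bc_sums_iff:
  "f sums Z \<longleftrightarrow> (\<forall>P\<in>{idem1, idem2}. (\<lambda>n. P (f n)) sums P Z)"
proof
  assume "\<forall>P\<in>{idem1, idem2}. (\<lambda>n. P (f n)) sums P Z"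
  then have "(\<lambda>n. of_idem (idem1 (f n)) 0) sums of_idem (idem1 Z) 0"
      "(\<lambda>n. of_idem 0 (idem2 (f n))) sums of_idem 0 (idem2 Z)"
    by (auto intro: bounded_linear.sums[OF bounded_linear_of_idem(1)]
        bounded_linear.sums[OF bounded_linear_of_idem(2)])
  from sums_add[OF this] show "f sums Z"
    by (simp add: of_idem_split)
qed (auto intro: bounded_linear.sums[OF bounded_linear_idem(1)]
        bounded_linear.sums[OF bounded_linear_idem(2)])

lemma bc_summable_iff: "summable f \<longleftrightarrow> (\<forall>P\<in>{idem1, idem2}. summable (\<lambda>n. P (f n)))"
proof
  assume *: "\<forall>P\<in>{idem1, idem2}. summable (\<lambda>n. P (f n))"
  have "f sums of_idem (\<Sum>n. idem1 (f n)) (\<Sum>n. idem2 (f n))"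
    using * by (auto simp: bc_sums_iff summable_sums)
  then show "summable f" by (rule sums_summable)
qed (auto simp: summable_def bc_sums_iff)

lemma idem_suminf:
  assumes "P \<in> {idem1, idem2}" "summable f"
  shows "P (\<Sum>n. f n) = (\<Sum>n. P (f n))"
  using summable_sums[OF assms(2)] assms(1) unfolding bc_sums_iff by (auto dest: sums_unique)

lemma bc_absolutely_integrable_iff:
  "f absolutely_integrable_on S \<longleftrightarrow>
     (\<forall>P\<in>{idem1, idem2}. (\<lambda>t. P (f t)) absolutely_integrable_on S)"
proof
  assume "\<forall>P\<in>{idem1, idem2}. (\<lambda>t. P (f t)) absolutely_integrable_on S"
  then have "(\<lambda>t. of_idem (idem1 (f t)) 0) absolutely_integrable_on S"
      "(\<lambda>t. of_idem 0 (idem2 (f t))) absolutely_integrable_on S"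
    using absolutely_integrable_linear[OF _ bounded_linear_of_idem(1), where f = "\<lambda>t. idem1 (f t)"]
      absolutely_integrable_linear[OF _ bounded_linear_of_idem(2), where f = "\<lambda>t. idem2 (f t)"]
    by (simp_all add: o_def)
  from set_integral_add(1)[OF this] show "f absolutely_integrable_on S"
    by (simp add: of_idem_split)
next
  assume "f absolutely_integrable_on S"
  then show "\<forall>P\<in>{idem1, idem2}. (\<lambda>t. P (f t)) absolutely_integrable_on S"
    using absolutely_integrable_linear[OF _ bounded_linear_idem(1), where f = f]
      absolutely_integrable_linear[OF _ bounded_linear_idem(2), where f = f]
    by (simp add: o_def)
qed

section \<open>Transfer of the equation and of the solution series\<close>

lemma idem_power_of_nat:
  "idem1 (Z ^ n) = idem1 Z ^ n" "idem2 (Z ^ n) = idem2 Z ^ n"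
  "idem1 (of_nat n) = of_nat n" "idem2 (of_nat n) = of_nat n"
  by (induction n) auto

lemma solves_frac_eq_iff:
  "solves_frac_eq V C c N0 N \<longleftrightarrow>
     (\<forall>P\<in>{idem1, idem2}. (\<forall>b>0. (\<lambda>t. P (N t)) absolutely_integrable_on {0..b}) \<and>
        (\<forall>t>0. RL_integrable (P V) (\<lambda>\<tau>. P (N \<tau>)) t \<and>
           P (N t) - P N0 * exp (P C * of_real t) =
             - P (bc_powr (of_real c) V) * RL_integral (P V) (\<lambda>\<tau>. P (N \<tau>)) t))"
  unfolding solves_frac_eq_def locally_integrable_def bc_absolutely_integrable_iff bc_idem_eq_iff
    bc_RL_integrable_def
  by (auto simp: bc_exp_def bc_RL_integral_def)

lemma idem_miller_ross_term:
  assumes "P \<in> {idem1, idem2}"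
  shows "P (miller_ross_term (V * of_nat k) C (of_real t) r) =
         (P C * of_real t) ^ r / Gamma (P V * of_nat k + of_nat r + 1)"
  using assms
  by (auto simp: miller_ross_term_def divide_bicomplex_def bc_Gamma_def idem_power_of_nat)

lemma idem_miller_ross:
  assumes "\<forall>P\<in>{idem1, idem2}. Re (P V) > 0" "P \<in> {idem1, idem2}"
  shows "t > 0 \<Longrightarrow> summable (miller_ross_term (V * of_nat k) C (of_real t))"
    and "t \<ge> 0 \<Longrightarrow> P (miller_ross (V * of_nat k) C (of_real t)) = mr_fun (P V) (P C) k t"
proof -
  show summ: "summable (miller_ross_term (V * of_nat k) C (of_real t))" if "t > 0"
    unfolding bc_summable_iff
  proof
    fix Q assume Q: "Q \<in> {idem1, idem2}"
    have "summable (\<lambda>r. mr_term (Q V) (Q C) k r t)"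
      using assms Q that by (intro summable_mr_term) auto
    \<comment> \<open>The prefactor is nonzero for \<open>t > 0\<close> and can be divided
      out.\<close>
    from summable_mult_D[OF this[unfolded mr_term_def]] that
    show "summable (\<lambda>r. Q (miller_ross_term (V * of_nat k) C (of_real t) r))"
      unfolding idem_miller_ross_term[OF Q] by simp
  qed
  have P_powr: "P (bc_powr (of_real t) (V * of_nat k) * Z) = of_real t powr (P V * of_nat k) * P Z" for Z
    using assms(2) by (auto simp: bc_powr_def idem_power_of_nat)
  show "P (miller_ross (V * of_nat k) C (of_real t)) = mr_fun (P V) (P C) k t" if "t \<ge> 0"
  proof (cases "t = 0")
    case False
    with that have t: "t > 0" by simp
    have "summable (\<lambda>r. P (miller_ross_term (V * of_nat k) C (of_real t) r))"
      using summ[OF t] assms(2) unfolding bc_summable_iff by blast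
    then show ?thesis
      by (simp add: miller_ross_def P_powr idem_suminf[OF assms(2) summ[OF t]]
          mr_fun_def mr_term_def idem_miller_ross_term[OF assms(2)] suminf_mult
          del: times_divide_eq_right)
  next
    case True
    then show ?thesis
      \<comment> \<open>At \<open>t = 0\<close> the prefactor is 0, whatever the value of the inner
        sum.\<close>
      unfolding miller_ross_def P_powr by (simp add: mr_fun_def)
  qed
qed

lemma idem_solution:
  assumes V: "\<forall>P\<in>{idem1, idem2}. Re (P V) > 0" and P: "P \<in> {idem1, idem2}" and t: "t \<ge> 0"
  shows "summable (\<lambda>k. N0 * (- K) ^ k * miller_ross (V * of_nat k) C (of_real t))"
    and "P (\<Sum>k. N0 * (- K) ^ k * miller_ross (V * of_nat k) C (of_real t)) =
         frac_sol (P V) (P C) (P K) (P N0) t"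
proof -
  have comp: "Q (N0 * (- K) ^ k * miller_ross (V * of_nat k) C (of_real t)) =
      Q N0 * (- Q K) ^ k * mr_fun (Q V) (Q C) k t" if "Q \<in> {idem1, idem2}" for Q k
    using that idem_miller_ross(2)[OF V that t, of k C] by (auto simp: idem_power_of_nat)
  have "summable (\<lambda>k. Q N0 * (- Q K) ^ k * mr_fun (Q V) (Q C) k t)" if "Q \<in> {idem1, idem2}" for Q
    using V that t by (intro summable_frac_sol) auto
  then show summ: "summable (\<lambda>k. N0 * (- K) ^ k * miller_ross (V * of_nat k) C (of_real t))"
    unfolding bc_summable_iff by (simp add: comp)
  show "P (\<Sum>k. N0 * (- K) ^ k * miller_ross (V * of_nat k) C (of_real t)) =
         frac_sol (P V) (P C) (P K) (P N0) t"
    by (simp add: idem_suminf[OF P summ] comp[OF P] frac_sol_def)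
qed

theorem theorem6p2:
  fixes \<alpha> \<beta> :: complex and V C N0 :: bicomplex and c :: real
  assumes "V = of_complex \<alpha> + bc_j * of_complex \<beta>"
    and "c > 0"
    and "Re \<alpha> > \<bar>Im \<beta>\<bar>"
  shows "(\<forall>t>0. (\<forall>k. summable (miller_ross_term (V * of_nat k) C (of_real t))) \<and>
              summable (\<lambda>k. N0 * (- bc_powr (of_real c) V) ^ k * miller_ross (V * of_nat k) C (of_real t)))
       \<and> solves_frac_eq V C c N0
           (\<lambda>t. \<Sum>k. N0 * (- bc_powr (of_real c) V) ^ k * miller_ross (V * of_nat k) C (of_real t))
       \<and> (\<forall>N. solves_frac_eq V C c N0 N \<longrightarrow>
              (\<forall>t>0. N t = (\<Sum>k. N0 * (- bc_powr (of_real c) V) ^ k * miller_ross (V * of_nat k) C (of_real t))))"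
    (is "_ \<and> solves_frac_eq V C c N0 ?S \<and> _")
proof (intro conjI)
  let ?K = "bc_powr (of_real c) V"
  \<comment> \<open>The components \<open>\<alpha> - \<i> * \<beta>\<close> and
    \<open>\<alpha> + \<i> * \<beta>\<close> have real parts \<open>Re \<alpha> + Im \<beta>\<close>
    and \<open>Re \<alpha> - Im \<beta>\<close>.\<close>
  have V: "\<forall>P\<in>{idem1, idem2}. Re (P V) > 0"
    using assms(1,3) by (simp add: idem1_def idem2_def of_complex_def bc_j_def abs_less_iff)
  have S: "P (?S t) = frac_sol (P V) (P C) (P ?K) (P N0) t" if "P \<in> {idem1, idem2}" "t \<ge> 0" for P t
    by (rule idem_solution(2)[OF V that])
  show "\<forall>t>0. (\<forall>k. summable (miller_ross_term (V * of_nat k) C (of_real t))) \<and>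
      summable (\<lambda>k. N0 * (- bc_powr (of_real c) V) ^ k * miller_ross (V * of_nat k) C (of_real t))"
    using idem_miller_ross(1)[OF V, of idem1] idem_solution(1)[OF V, of idem1] by auto
  show "solves_frac_eq V C c N0 ?S"
    unfolding solves_frac_eq_iff
  proof (intro ballI conjI allI impI)
    fix P and t :: real
    assume P: "P \<in> {idem1, idem2}" and t: "t > 0"
    let ?g = "frac_sol (P V) (P C) (P ?K) (P N0)"
    have \<nu>: "Re (P V) > 0" using V P by blast
    \<comment> \<open>The two functions are only known to agree at nonnegative arguments, so
      integrals are transferred by congruence on \<open>{0..t}\<close>.\<close>
    have Sg: "P (?S \<tau>) = ?g \<tau>" if "\<tau> \<in> {0..t}" for \<tau>
      using that by (intro S P) auto
    show "(\<lambda>t. P (?S t)) absolutely_integrable_on {0..t}"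
      using frac_sol_absolutely_integrable[OF \<nu> t] Sg[symmetric]
      by (rule set_integrable_cong[OF refl refl, THEN iffD1, rotated])
    have "RL_integral (P V) (\<lambda>\<tau>. P (?S \<tau>)) t = RL_integral (P V) ?g t"
      by (rule RL_integral_cong[OF Sg])
    then show "P (?S t) - P N0 * exp (P C * of_real t) = - P ?K * RL_integral (P V) (\<lambda>\<tau>. P (?S \<tau>)) t"
      using frac_sol_solves(2)[OF \<nu> t] Sg[of t] t by simp
    show "RL_integrable (P V) (\<lambda>\<tau>. P (?S \<tau>)) t"
      using frac_sol_solves(1)[OF \<nu> t, of "P C" "P ?K" "P N0"] unfolding RL_integrable_def
      by (rule set_integrable_cong[OF refl refl, THEN iffD1, rotated]) (simp add: Sg)
  qed
  show "\<forall>N. solves_frac_eq V C c N0 N \<longrightarrow> (\<forall>t>0. N t = ?S t)"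
  proof (intro allI impI)
    fix N and t :: real
    assume N: "solves_frac_eq V C c N0 N" and t: "t > 0"
    have "P (N t) = P (?S t)" if P: "P \<in> {idem1, idem2}" for P
    proof -
      have "P (N t) = frac_sol (P V) (P C) (P ?K) (P N0) t"
        using V P t N[unfolded solves_frac_eq_iff] by (intro frac_sol_unique) blast+
      then show ?thesis using S[OF P] t by simp
    qed
    then show "N t = ?S t" by (simp add: bc_idem_eq_iff)
  qed
qed

end
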